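(* Let $c>1$ be real, $N\ge0$ an integer, $L=\log c$, $\rho=2\pi/L$, and let $T_2>T_1>\max(\rho N,7)$. Then the matrix $$\Delta_{T_1,T_2}:=Q_{{\rm arch},T_2}-Q_{{\rm arch},T_1}$$ has the exact representation $$\Delta_{T_1,T_2}=\frac1{\pi^2}\int_{T_1}^{T_2}h_+(T)\,\frac{\sin^2(LT/2)}{\rho}\,\bigl(p_Tp_T^{\mathsf t}+q_Tq_T^{\mathsf t}\bigr)\,dT .$$ Consequently $\Delta_{T_1,T_2}$ is positive definite on the full complex space $\mathbb C^{I_N}$, and hence on the real even subspace $\{x\in\mathbb R^{I_N}:x_{-k}=x_k\}$. Moreover, in the natural order $-N<\cdots<N$ of the index set, every minor of $\Delta_{T_1,T_2}$ with increasing row and column sets is strictly positive (that is, for all $1\le k\le 2N+1$ and all $m_1<\cdots<m_k$, $n_1<\cdots<n_k$ in $I_N$, $\det[(\Delta_{T_1,T_2})_{m_in_j}]_{i,j=1}^k>0$).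
   Context: Notation. $I_N=\{-N,\dots,N\}$. For a $C^1$ function $\psi$ on $\mathbb R$, $Q_\psi$ is the matrix indexed by $I_N\times I_N$ with $(Q_\psi)_{mn}=\frac{\psi(m)-\psi(n)}{m-n}$ for $m\ne n$ and $(Q_\psi)_{mm}=\psi'(m)$. Let $\psi_\Gamma=\Gamma'/\Gamma$ be the digamma function and $h_+(r)=\operatorname{Re}\psi_\Gamma(\tfrac14+\tfrac{ir}2)-\log\pi$. Define, for $T>0$, $$\psi_{\mathbb R,T}(x)=\frac1{2\pi^2}\int_{-T}^Th_+(r)\,\mathcal S(r,x,L)\,dr,\qquad \mathcal S(r,x,L)=\int_0^L\sin\!\bigl(2\pi x(1-\tfrac yL)\bigr)\cos(ry)\,dy,$$ and $Q_{{\rm arch},T}=Q_{\psi_{\mathbb R,T}}$. For $T>\rho N$ put $a_T=T/\rho$ and let $p_T,q_T\in\mathbb R^{I_N}$ be the column vectors with entries $p_T(n)=\frac1{a_T-n}$, $q_T(n)=\frac1{a_T+n}$ for $n\in I_N$. *)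

theory Defs
  imports "HOL-Analysis.Analysis" "Jordan_Normal_Form.Determinant"
begin

text \<open>
  Matrices indexed by \<open>I\<^sub>N \<times> I\<^sub>N\<close> and vectors indexed by \<open>I\<^sub>N\<close> are functions on the integers,
  of which only the values at indices in \<open>I\<^sub>N\<close> are ever used.
\<close>

definition idx :: "nat \<Rightarrow> int set" where
  "idx N = {- int N..int N}"

definition Qmat :: "(real \<Rightarrow> real) \<Rightarrow> int \<Rightarrow> int \<Rightarrow> real" where
  "Qmat \<psi> m n =
     (if m = n then deriv \<psi> (real_of_int m)
      else (\<psi> (real_of_int m) - \<psi> (real_of_int n)) / (real_of_int m - real_of_int n))"

text \<open>The library's \<open>Digamma\<close> is the logarithmic derivative of \<open>Gamma\<close>:\<close>

lemma deriv_Gamma_over_Gamma_eq_Digamma: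
  fixes z :: complex
  assumes "z \<notin> \<int>\<^sub>\<le>\<^sub>0"
  shows "deriv Gamma z / Gamma z = Digamma z"
  using DERIV_imp_deriv[OF has_field_derivative_Gamma[OF assms]] Gamma_eq_zero_iff[of z] assms
  by simp

definition h_plus :: "real \<Rightarrow> real" where
  "h_plus r = Re (Digamma (1 / 4 + \<i> * complex_of_real r / 2)) - ln pi"

definition S_ker :: "real \<Rightarrow> real \<Rightarrow> real \<Rightarrow> real" where
  "S_ker r x L = integral {0..L} (\<lambda>y. sin (2 * pi * x * (1 - y / L)) * cos (r * y))"

definition psi_arch :: "real \<Rightarrow> real \<Rightarrow> real \<Rightarrow> real" where
  "psi_arch L T x = 1 / (2 * pi\<^sup>2) * integral {- T..T} (\<lambda>r. h_plus r * S_ker r x L)"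

definition Q_arch :: "real \<Rightarrow> real \<Rightarrow> int \<Rightarrow> int \<Rightarrow> real" where
  "Q_arch L T = Qmat (psi_arch L T)"

definition Delta_arch :: "real \<Rightarrow> real \<Rightarrow> real \<Rightarrow> int \<Rightarrow> int \<Rightarrow> real" where
  "Delta_arch L T\<^sub>1 T\<^sub>2 m n = Q_arch L T\<^sub>2 m n - Q_arch L T\<^sub>1 m n"

definition p_vec :: "real \<Rightarrow> real \<Rightarrow> int \<Rightarrow> real" where
  "p_vec \<rho> T n = 1 / (T / \<rho> - real_of_int n)"

definition q_vec :: "real \<Rightarrow> real \<Rightarrow> int \<Rightarrow> real" where
  "q_vec \<rho> T n = 1 / (T / \<rho> + real_of_int n)"

definition outer :: "(int \<Rightarrow> real) \<Rightarrow> (int \<Rightarrow> real) \<Rightarrow> int \<Rightarrow> int \<Rightarrow> real" where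
  "outer u v m n = u m * v n"

definition complex_pos_def_on :: "int set \<Rightarrow> (int \<Rightarrow> int \<Rightarrow> complex) \<Rightarrow> bool" where
  "complex_pos_def_on I A \<longleftrightarrow>
     (\<forall>m\<in>I. \<forall>n\<in>I. A n m = cnj (A m n)) \<and>
     (\<forall>x :: int \<Rightarrow> complex. (\<exists>k\<in>I. x k \<noteq> 0) \<longrightarrow>
        (\<Sum>m\<in>I. \<Sum>n\<in>I. cnj (x m) * A m n * x n) \<in> \<real> \<and>
        Re (\<Sum>m\<in>I. \<Sum>n\<in>I. cnj (x m) * A m n * x n) > 0)"

definition pos_def_on_even :: "int set \<Rightarrow> (int \<Rightarrow> int \<Rightarrow> real) \<Rightarrow> bool" where
  "pos_def_on_even I A \<longleftrightarrow>
     (\<forall>x :: int \<Rightarrow> real. (\<forall>k\<in>I. x (- k) = x k) \<longrightarrow> (\<exists>k\<in>I. x k \<noteq> 0) \<longrightarrow>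
        (\<Sum>m\<in>I. \<Sum>n\<in>I. x m * A m n * x n) > 0)"

text \<open>The rows \<open>ms 0, \<dots>, ms (k - 1)\<close> and columns \<open>ns 0, \<dots>, ns (k - 1)\<close> are counted from zero.\<close>

definition minor :: "nat \<Rightarrow> (int \<Rightarrow> int \<Rightarrow> real) \<Rightarrow> (nat \<Rightarrow> int) \<Rightarrow> (nat \<Rightarrow> int) \<Rightarrow> real" where
  "minor k A ms ns = Determinant.det (Matrix.mat k k (\<lambda>(i, j). A (ms i) (ns j)))"

end

theory Submission
  imports Defs "HOL-Real_Asymp.Real_Asymp"
begin

text \<open>
The matrix \<open>\<Delta>\<close> is a Gram matrix of Cauchy vectors.  At an integer \<open>k\<close> one has \<open>cos (2 * pi * k) = 1\<close>, so
\<open>S_ker r k L\<close> equals \<open>sin\<^sup>2 (L * r / 2) * (1 / (r - \<rho> * k) - 1 / (r + \<rho> * k))\<close>, and divided differences of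
\<open>1 / (r - x)\<close> are products of simple fractions.  On the diagonal the factor \<open>cos (2 * pi * x)\<close> is stationary at
integers, so the derivative follows the same pattern.  Since \<open>h_plus\<close> and \<open>S_ker\<close> are even in the frequency, the
difference of the two truncations is twice the integral over \<open>{T\<^sub>1..T\<^sub>2}\<close>, which gives the representation
(\<open>S_quot_eq_rank_two\<close>, \<open>Delta_arch_eq_integral\<close>).  In terms of nodes \<open>\<rho> * m\<close>, \<open>\<rho> * n\<close> the entries are values of
the kernel \<open>ker u v = \<integral> w T * (1 / ((T - u) * (T - v)) + 1 / ((T + u) * (T + v))) dT\<close> with a weight \<open>w\<close>.

The weight is positive off a countable set because \<open>h_plus\<close> is positive from \<open>7\<close> on (\<open>h_plus_pos\<close>).  The series for
the digamma function is compared term by term with a telescoping sum of logarithms, which yields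
\<open>Re (Digamma (1 / 4 + \<i> * s)) \<ge> ln (s\<^sup>2 - 3 / 16) / 2\<close>; at \<open>s \<ge> 7 / 2\<close> this exceeds \<open>ln pi\<close>.

Positivity of the minors rests on a single integral of a square.  Given coefficients \<open>c\<close>, write
\<open>\<Sum> c i / (x - v i) = P x / \<Prod> (x - v i)\<close>; by Lagrange interpolation the same numerator \<open>P\<close> occurs as
\<open>\<Sum> d i / (x - u i) = P x / \<Prod> (x - u i)\<close> for suitable \<open>d\<close>
(\<open>exists_partial_fraction_same_numerator\<close>).  Then \<open>\<Sum> d i * ker (u i) (v j) * c j\<close> is the weighted integral of
\<open>(P x)\<^sup>2 / \<Prod> (x - u i) * (x - v i)\<close> at \<open>x = T\<close> and at \<open>x = - T\<close>, and the denominator is positive at both points because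
all factors have the same sign.  Hence the bilinear form is positive at \<open>(d, c)\<close> (\<open>bilinear_ker_pos\<close>).  For \<open>u = v\<close>
one takes \<open>d = c\<close> and obtains positive definiteness.  For arbitrary distinct real nodes one obtains that the matrix
\<open>ker (u i) (v j)\<close> is nonsingular.  Two increasing families of nodes can be joined by straight lines through increasing
families, so along the way the determinant keeps the sign that it has for \<open>u = v\<close>, where it is positive
(\<open>ker_strictly_totally_positive\<close>).
\<close>

section \<open>Positivity of the digamma weight\<close>

lemma continuous_on_h_plus: "continuous_on A h_plus"
proof -
  have arg: "continuous_on UNIV (\<lambda>r. 1 / 4 + \<i> * complex_of_real r / 2)"
    by (intro continuous_intros) auto
  have "continuous_on {z. Re z > 0} (Polygamma 0 :: complex \<Rightarrow> complex)"
    by (rule continuous_on_Polygamma) (auto elim!: nonpos_Ints_cases)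
  then have "continuous_on UNIV (\<lambda>r. Digamma (1 / 4 + \<i> * complex_of_real r / 2))"
    by (rule continuous_on_compose2[OF _ arg]) auto
  then have "continuous_on UNIV h_plus"
    unfolding h_plus_def by (intro continuous_intros)
  then show ?thesis
    by (rule continuous_on_subset) auto
qed

lemma Re_inverse_quarter_add:
  "Re (inverse (1 / 4 + \<i> * complex_of_real r / 2 + of_nat n)) =
    (real n + 1/4) / ((real n + 1/4)\<^sup>2 + (r / 2)\<^sup>2)"
  by (simp add: add.commute)

lemma Re_Digamma_LIMSEQ:
  "(\<lambda>n. ln (real n) - (\<Sum>k<n. (real k + 1/4) / ((real k + 1/4)\<^sup>2 + (r / 2)\<^sup>2)))
     \<longlonglongrightarrow> Re (Digamma (1 / 4 + \<i> * complex_of_real r / 2))"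
proof -
  have "1 / 4 + \<i> * complex_of_real r / 2 \<noteq> 0"
    by (simp add: complex_eq_iff)
  from tendsto_Re[OF Digamma_LIMSEQ[OF this]] show ?thesis
    by (simp add: Re_inverse_quarter_add del: inverse_complex.sel)
qed

lemma h_plus_minus [simp]: "h_plus (- r) = h_plus r"
  using LIMSEQ_unique[OF Re_Digamma_LIMSEQ[of r]] Re_Digamma_LIMSEQ[of "- r"]
  unfolding h_plus_def by simp

text \<open>
The inequality \<open>x \<le> artanh x\<close>, written with the two logarithms separate so that sums of it telescope.
\<close>

lemma twice_le_ln_diff:
  fixes x :: real
  assumes "0 \<le> x" "x < 1"
  shows "2 * x \<le> ln (1 + x) - ln (1 - x)"
proof -
  let ?f = "\<lambda>x::real. ln (1 + x) - ln (1 - x) - 2 * x"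
  have "?f 0 \<le> ?f x"
  proof (rule DERIV_nonneg_imp_nondecreasing[OF assms(1)], intro exI conjI)
    fix y assume y: "0 \<le> y" "y \<le> x"
    with assms show "(?f has_real_derivative (1 / (1 + y) + 1 / (1 - y) - 2)) (at y)"
      by (auto intro!: derivative_eq_intros)
    have "y\<^sup>2 < 1" using y assms by (simp add: abs_square_less_1)
    then have "1 / (1 + y) + 1 / (1 - y) - 2 = 2 * y\<^sup>2 / (1 - y\<^sup>2)"
      using y assms by (simp add: field_simps power2_eq_square)
    then show "0 \<le> 1 / (1 + y) + 1 / (1 - y) - 2"
      using \<open>y\<^sup>2 < 1\<close> by simp
  qed
  then show ?thesis by simp
qed

text \<open>
The shift by \<open>1 / 4\<close> is what makes the comparison exact: with it the two arguments of the logarithm are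
\<open>(t\<^sup>2 + s\<^sup>2) * (1 \<plusminus> x)\<close> for \<open>x = t / (t\<^sup>2 + s\<^sup>2)\<close>, so the right-hand side is \<open>artanh x\<close>.
\<close>

lemma ratio_le_half_ln_diff:
  fixes t s :: real
  assumes "t \<ge> 0" "s\<^sup>2 > 1 / 4"
  shows "t / (t\<^sup>2 + s\<^sup>2) \<le>
    ln ((t + 1 / 2)\<^sup>2 + s\<^sup>2 - 1 / 4) / 2 - ln ((t - 1 / 2)\<^sup>2 + s\<^sup>2 - 1 / 4) / 2"
proof -
  define A where "A = t\<^sup>2 + s\<^sup>2"
  have A: "A > 0" using assms by (auto simp: A_def intro!: add_nonneg_pos intro: less_trans[of 0 "1 / 4"])
  have "(t - 1 / 2)\<^sup>2 + (s\<^sup>2 - 1 / 4) > 0"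
    using assms by (intro add_nonneg_pos) auto
  moreover have minus: "(t - 1 / 2)\<^sup>2 + s\<^sup>2 - 1 / 4 = A * (1 - t / A)"
    using A by (simp add: right_diff_distrib) (simp add: A_def power2_eq_square algebra_simps)
  moreover have plus: "(t + 1 / 2)\<^sup>2 + s\<^sup>2 - 1 / 4 = A * (1 + t / A)"
    using A by (simp add: distrib_left) (simp add: A_def power2_eq_square algebra_simps)
  ultimately have pos: "A * (1 - t / A) > 0" by simp
  then have lt: "t / A < 1" using A by (simp add: zero_less_mult_iff)
  have ge: "0 \<le> t / A" using assms A by simp
  have "2 * (t / A) \<le> ln (1 + t / A) - ln (1 - t / A)"
    by (rule twice_le_ln_diff[OF ge lt])
  also have "\<dots> = ln (A * (1 + t / A)) - ln (A * (1 - t / A))"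
    using A ge lt by (simp add: ln_mult)
  finally show ?thesis unfolding A_def[symmetric] plus minus by linarith
qed

text \<open>
Apply \<open>ratio_le_half_ln_diff\<close> at \<open>t = k + 1 / 4\<close> and telescope.  The upper end of the telescoping sum is asymptotic to
\<open>ln n\<close> and cancels against the logarithm in the digamma limit; the lower end is the claimed bound.
\<close>

lemma Re_Digamma_quarter_ge:
  assumes "(r / 2)\<^sup>2 > 1 / 4"
  shows "Re (Digamma (1 / 4 + \<i> * complex_of_real r / 2)) \<ge> ln ((r / 2)\<^sup>2 - 3 / 16) / 2"
proof -
  define s where "s = r / 2"
  define \<Phi> where "\<Phi> = (\<lambda>k. ln ((real k - 1 / 4)\<^sup>2 + s\<^sup>2 - 1 / 4) / 2)"
  have "(real k + 1/4) / ((real k + 1/4)\<^sup>2 + s\<^sup>2) \<le> \<Phi> (Suc k) - \<Phi> k" for k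
  proof -
    have "real (Suc k) - 1 / 4 = real k + 1 / 4 + 1 / 2" "real k - 1 / 4 = real k + 1 / 4 - 1 / 2"
      by simp_all
    moreover have "s\<^sup>2 > 1 / 4" using assms by (simp add: s_def)
    ultimately show ?thesis
      using ratio_le_half_ln_diff[of "real k + 1 / 4" s] unfolding \<Phi>_def by simp
  qed
  then have "(\<Sum>k<n. (real k + 1/4) / ((real k + 1/4)\<^sup>2 + s\<^sup>2)) \<le> (\<Sum>k<n. \<Phi> (Suc k) - \<Phi> k)" for n
    by (intro sum_mono)
  then have sum_le: "(\<Sum>k<n. (real k + 1/4) / ((real k + 1/4)\<^sup>2 + s\<^sup>2)) \<le> \<Phi> n - \<Phi> 0" for n
    by (simp add: sum_lessThan_telescope)
  have "(\<lambda>n. ln (real n) - \<Phi> n + \<Phi> 0) \<longlonglongrightarrow> 0 + \<Phi> 0"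
    unfolding \<Phi>_def by (intro tendsto_intros) real_asymp
  then have "0 + \<Phi> 0 \<le> Re (Digamma (1 / 4 + \<i> * complex_of_real r / 2))"
    by (rule LIMSEQ_le[OF _ Re_Digamma_LIMSEQ]) (use sum_le in \<open>auto simp: s_def algebra_simps intro!: exI[of _ 0]\<close>)
  then show ?thesis by (simp add: \<Phi>_def s_def power2_eq_square algebra_simps)
qed

lemma arctan_le_self:
  fixes x :: real
  assumes "0 \<le> x"
  shows "arctan x \<le> x"
proof -
  have "0 - arctan 0 \<le> x - arctan x"
  proof (rule DERIV_nonneg_imp_nondecreasing[OF assms], intro exI conjI)
    fix y :: real
    show "((\<lambda>x. x - arctan x) has_real_derivative 1 - inverse (1 + y\<^sup>2)) (at y)"
      by (auto intro!: derivative_eq_intros)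
    have "inverse (1 + y\<^sup>2) \<le> inverse 1" by (rule le_imp_inverse_le) auto
    then show "0 \<le> 1 - inverse (1 + y\<^sup>2)" by simp
  qed
  then show ?thesis by simp
qed

lemma pi_le_16_fifths: "pi \<le> 16 / 5"
proof -
  have "arctan (1 / 5) \<le> 1 / 5" by (rule arctan_le_self) simp
  moreover have "0 \<le> arctan (1 / 239)" by simp
  ultimately show ?thesis using machin by linarith
qed

text \<open>
From \<open>7\<close> on the lower bound has \<open>s\<^sup>2 - 3 / 16 \<ge> 12.0625\<close>, while \<open>pi\<^sup>2 \<le> 10.24\<close>.
\<close>

lemma h_plus_pos:
  assumes "r \<ge> 7"
  shows "h_plus r > 0"
proof -
  have r: "(r / 2)\<^sup>2 \<ge> (7 / 2)\<^sup>2" using assms by (intro power_mono) auto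
  have "pi\<^sup>2 \<le> (16 / 5)\<^sup>2" using pi_le_16_fifths by (intro power_mono) auto
  then have "pi\<^sup>2 < (r / 2)\<^sup>2 - 3 / 16" using r by (simp add: power2_eq_square)
  moreover have "0 < pi\<^sup>2" by simp
  ultimately have "ln (pi\<^sup>2) < ln ((r / 2)\<^sup>2 - 3 / 16)"
    by (metis ln_less_cancel_iff less_trans)
  then have "ln pi < ln ((r / 2)\<^sup>2 - 3 / 16) / 2" by (simp add: ln_realpow)
  moreover have "(r / 2)\<^sup>2 > 1 / 4" using r by (simp add: power2_eq_square)
  ultimately show ?thesis using Re_Digamma_quarter_ge[of r] by (simp add: h_plus_def)
qed

section \<open>Partial fractions\<close>

text \<open>
The numerator of the rational function \<open>\<Sum> c i / (x - u i)\<close> over the common denominator \<open>\<Prod> (x - u i)\<close>.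
\<close>

definition numerator :: "'i set \<Rightarrow> ('i \<Rightarrow> real) \<Rightarrow> ('i \<Rightarrow> real) \<Rightarrow> real poly" where
  "numerator I u c = (\<Sum>i\<in>I. Polynomial.smult (c i) (\<Prod>j\<in>I - {i}. [:- u j, 1:]))"

lemma partial_fraction_eq_quotient:
  fixes u c :: "'i \<Rightarrow> real"
  assumes "finite I" "x \<notin> u ` I"
  shows "(\<Sum>i\<in>I. c i / (x - u i)) =
    poly (numerator I u c) x / (\<Prod>i\<in>I. x - u i)"
proof -
  have "c i / (x - u i) = c i * (\<Prod>j\<in>I - {i}. x - u j) / (\<Prod>i\<in>I. x - u i)" if "i \<in> I" for i
  proof -
    have "(\<Prod>i\<in>I. x - u i) = (x - u i) * (\<Prod>j\<in>I - {i}. x - u j)"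
      using assms(1) that by (rule prod.remove)
    moreover have "(\<Prod>j\<in>I - {i}. x - u j) \<noteq> 0" "x - u i \<noteq> 0"
      using assms that by auto
    ultimately show ?thesis by simp
  qed
  then show ?thesis
    by (simp add: numerator_def poly_sum poly_prod sum_divide_distrib)
qed

lemma poly_numerator_at_pole:
  fixes u c :: "'i \<Rightarrow> real"
  assumes "finite I" "k \<in> I"
  shows "poly (numerator I u c) (u k) =
    c k * (\<Prod>j\<in>I - {k}. u k - u j)"
proof -
  have "(\<Prod>j\<in>I - {i}. u k - u j) = 0" if "i \<noteq> k" for i
    using assms that by (intro prod_zero) auto
  then have "(\<Sum>i\<in>I. c i * (\<Prod>j\<in>I - {i}. u k - u j)) =
      (\<Sum>i\<in>I. if i = k then c k * (\<Prod>j\<in>I - {k}. u k - u j) else 0)"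
    by (intro sum.cong) auto
  then show ?thesis using assms by (simp add: numerator_def poly_sum poly_prod)
qed

lemma degree_numerator_less:
  fixes u c :: "'i \<Rightarrow> real"
  assumes "finite I" "I \<noteq> {}"
  shows "degree (numerator I u c) < card I"
proof -
  have "degree (Polynomial.smult (c i) (\<Prod>j\<in>I - {i}. [:- u j, 1:])) \<le> card I - 1" if "i \<in> I" for i
  proof -
    have "degree (\<Prod>j\<in>I - {i}. [:- u j, 1:]) \<le> (\<Sum>j\<in>I - {i}. degree [:- u j, 1:])"
      using assms degree_prod_sum_le[of "I - {i}" "\<lambda>j. [:- u j, 1:]"] by (simp add: o_def)
    then show ?thesis using that assms(1) le_trans[OF degree_smult_le] by simp
  qed
  then have "degree (numerator I u c) \<le> card I - 1"
    using assms(1) unfolding numerator_def by (intro degree_sum_le) auto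
  moreover have "card I > 0" using assms by auto
  ultimately show ?thesis by linarith
qed

text \<open>
A proper fraction over the poles \<open>v\<close> can be moved to the poles \<open>u\<close> without changing its numerator, since the numerators
over any set of simple poles are exactly the polynomials of degree below the number of poles.  This supplies the test vector
\<open>d\<close> that certifies nonsingularity of a Cauchy-type matrix.
\<close>

lemma exists_partial_fraction_same_numerator:
  fixes u v c :: "'i \<Rightarrow> real"
  assumes "finite I" "inj_on u I" "inj_on v I" "k \<in> I" "c k \<noteq> 0"
  obtains d P where "P \<noteq> 0"
    and "\<And>x. x \<notin> u ` I \<Longrightarrow> (\<Sum>i\<in>I. d i / (x - u i)) = poly P x / (\<Prod>i\<in>I. x - u i)"
    and "\<And>x. x \<notin> v ` I \<Longrightarrow> (\<Sum>i\<in>I. c i / (x - v i)) = poly P x / (\<Prod>i\<in>I. x - v i)"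
proof -
  define P where "P = numerator I v c"
  \<comment> \<open>The Lagrange coefficients of \<open>P\<close> at the new poles.\<close>
  define d where "d i = poly P (u i) / (\<Prod>j\<in>I - {i}. u i - u j)" for i
  define R where "R = numerator I u d"
  have "(\<Prod>j\<in>I - {k}. v k - v j) \<noteq> 0"
    using assms by (auto simp: inj_on_def)
  then have "poly P (v k) \<noteq> 0"
    using assms by (simp add: P_def poly_numerator_at_pole)
  then have "P \<noteq> 0" by auto
  moreover have "R = P"
  proof (rule poly_eqI_degree)
    fix x assume "x \<in> u ` I"
    then obtain i where i: "i \<in> I" "x = u i" by auto
    have "(\<Prod>j\<in>I - {i}. u i - u j) \<noteq> 0"
      using assms i by (auto simp: inj_on_def)
    then show "poly R x = poly P x"
      using assms i by (simp add: R_def poly_numerator_at_pole d_def)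
  qed (use assms degree_numerator_less[of I] in \<open>auto simp: R_def P_def card_image\<close>)
  ultimately show ?thesis
    using that[of P d] partial_fraction_eq_quotient[OF assms(1)] P_def R_def by metis
qed

section \<open>Determinants\<close>

lemma continuous_on_det:
  fixes A :: "real \<Rightarrow> nat \<Rightarrow> nat \<Rightarrow> real"
  assumes "\<And>i j. i < k \<Longrightarrow> j < k \<Longrightarrow> continuous_on S (\<lambda>t. A t i j)"
  shows "continuous_on S (\<lambda>t. Determinant.det (Matrix.mat k k (\<lambda>(i, j). A t i j)))"
proof -
  have "continuous_on S (\<lambda>t. \<Sum>p | p permutes {0..<k}. signof p * (\<Prod>i = 0..<k. A t i (p i)))"
    using assms by (intro continuous_intros) (auto simp: permutes_in_image)
  moreover have "Determinant.det (Matrix.mat k k (\<lambda>(i, j). A t i j)) =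
      (\<Sum>p | p permutes {0..<k}. signof p * (\<Prod>i = 0..<k. A t i (p i)))" for t
    by (subst Determinant.det_def') (auto intro!: sum.cong prod.cong arg_cong2[where f = times] simp: permutes_in_image)
  ultimately show ?thesis by simp
qed

text \<open>
A kernel vector \<open>c\<close> would annihilate every bilinear value \<open>d\<^sup>T A c\<close>.
\<close>

lemma det_ne_0_if_bilinear_pos:
  fixes A :: "nat \<Rightarrow> nat \<Rightarrow> real"
  assumes "\<And>c i. i < k \<Longrightarrow> c i \<noteq> 0 \<Longrightarrow> \<exists>d. (\<Sum>i<k. \<Sum>j<k. d i * A i j * c j) > 0"
  shows "Determinant.det (Matrix.mat k k (\<lambda>(i, j). A i j)) \<noteq> 0"
proof
  let ?M = "Matrix.mat k k (\<lambda>(i, j). A i j)"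
  assume "Determinant.det ?M = 0"
  then obtain v where v: "v \<in> carrier_vec k" "v \<noteq> 0\<^sub>v k" "?M *\<^sub>v v = 0\<^sub>v k"
    using det_0_iff_vec_prod_zero_field[of ?M k] by auto
  from v(1,2) obtain i where "i < k" "vec_index v i \<noteq> 0"
    by (metis eq_vecI index_zero_vec carrier_vecD)
  from assms[of i "\<lambda>i. vec_index v i", OF this] obtain d
    where d: "(\<Sum>i<k. \<Sum>j<k. d i * A i j * (vec_index v j)) > 0" by blast
  have "(\<Sum>j<k. A i j * (vec_index v j)) = 0" if "i < k" for i
  proof -
    have "vec_index (?M *\<^sub>v v) i = 0" using v(3) that by simp
    then show ?thesis using v(1) that by (simp add: scalar_prod_def atLeast0LessThan)
  qed
  then have "(\<Sum>i<k. d i * (\<Sum>j<k. A i j * (vec_index v j))) = 0" by simp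
  with d show False by (simp add: sum_distrib_left mult.assoc)
qed

text \<open>
By the intermediate value theorem a determinant that never vanishes along a path keeps its sign.
\<close>

lemma det_pos_homotopy:
  fixes A :: "real \<Rightarrow> nat \<Rightarrow> nat \<Rightarrow> real"
  assumes cont: "\<And>i j. i < k \<Longrightarrow> j < k \<Longrightarrow> continuous_on {0..1} (\<lambda>t. A t i j)"
    and ne: "\<And>t. t \<in> {0..1} \<Longrightarrow> Determinant.det (Matrix.mat k k (\<lambda>(i, j). A t i j)) \<noteq> 0"
    and one: "Determinant.det (Matrix.mat k k (\<lambda>(i, j). A 1 i j)) > 0"
  shows "Determinant.det (Matrix.mat k k (\<lambda>(i, j). A 0 i j)) > 0"
proof (rule ccontr)
  assume "\<not> Determinant.det (Matrix.mat k k (\<lambda>(i, j). A 0 i j)) > 0"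
  with one continuous_on_det[OF cont]
  obtain t where "0 \<le> t" "t \<le> 1" "Determinant.det (Matrix.mat k k (\<lambda>(i, j). A t i j)) = 0"
    using IVT'[of "\<lambda>t. Determinant.det (Matrix.mat k k (\<lambda>(i, j). A t i j))" 0 0 1] by force
  with ne show False by auto
qed

text \<open>
Convex combinations of \<open>A\<close> with the identity stay positive definite, hence nonsingular, so the sign is that of the identity.
\<close>

lemma det_pos_if_pos_def:
  fixes A :: "nat \<Rightarrow> nat \<Rightarrow> real"
  assumes pd: "\<And>c i. i < k \<Longrightarrow> c i \<noteq> 0 \<Longrightarrow> (\<Sum>i<k. \<Sum>j<k. c i * A i j * c j) > 0"
  shows "Determinant.det (Matrix.mat k k (\<lambda>(i, j). A i j)) > 0"
proof -
  define B where "B t i j = (1 - t) * A i j + t * (if i = j then 1 else 0)" for t :: real and i j :: nat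
  have "Matrix.mat k k (\<lambda>(i, j). B 1 i j) = 1\<^sub>m k" by (auto simp: B_def)
  then have one: "Determinant.det (Matrix.mat k k (\<lambda>(i, j). B 1 i j)) > 0" by simp
  have "Determinant.det (Matrix.mat k k (\<lambda>(i, j). B t i j)) \<noteq> 0" if t: "t \<in> {0..1}" for t
  proof (rule det_ne_0_if_bilinear_pos, rule exI)
    fix c :: "nat \<Rightarrow> real" and i assume i: "i < k" "c i \<noteq> 0"
    have "(\<Sum>j<k. c i * B t i j * c j) =
        (1 - t) * (\<Sum>j<k. c i * A i j * c j) + t * (c i)\<^sup>2" if "i < k" for i
    proof -
      have "(\<Sum>j<k. c i * B t i j * c j) =
          (\<Sum>j<k. (1 - t) * (c i * A i j * c j) + (if i = j then t * (c i)\<^sup>2 else 0))"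
        by (intro sum.cong) (auto simp: B_def algebra_simps power2_eq_square)
      then show ?thesis using that by (simp add: sum.distrib sum_distrib_left)
    qed
    then have eq: "(\<Sum>i<k. \<Sum>j<k. c i * B t i j * c j) =
        (1 - t) * (\<Sum>i<k. \<Sum>j<k. c i * A i j * c j) + t * (\<Sum>i<k. (c i)\<^sup>2)"
      by (simp add: sum.distrib sum_distrib_left)
    have "(\<Sum>i<k. (c i)\<^sup>2) > 0" using i by (intro sum_pos2[of _ i]) auto
    moreover have "(\<Sum>i<k. \<Sum>j<k. c i * A i j * c j) > 0" by (rule pd[of i c]) (use i in auto)
    ultimately show "(\<Sum>i<k. \<Sum>j<k. c i * B t i j * c j) > 0"
      using t unfolding eq by (cases "t = 0") (auto intro!: add_nonneg_pos)
  qed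
  then have "Determinant.det (Matrix.mat k k (\<lambda>(i, j). B 0 i j)) > 0"
    by (intro det_pos_homotopy[of k B] one) (auto simp: B_def intro!: continuous_intros)
  then show ?thesis by (simp add: B_def)
qed

section \<open>A strictly totally positive kernel\<close>

text \<open>
The zeros of the weight may form any countable set: an interval is uncountable, so a nonzero polynomial cannot vanish at
all the points where the weight is positive.
\<close>

locale weighted_kernel =
  fixes w :: "real \<Rightarrow> real" and \<alpha> \<beta> :: real
  assumes less: "0 < \<alpha>" "\<alpha> < \<beta>"
    and w_cont: "continuous_on {\<alpha>..\<beta>} w"
    and w_nonneg: "\<And>T. T \<in> {\<alpha>..\<beta>} \<Longrightarrow> 0 \<le> w T"
    and w_zeros: "countable {T \<in> {\<alpha>..\<beta>}. w T = 0}"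
begin

definition ker :: "real \<Rightarrow> real \<Rightarrow> real" where
  "ker u v = integral {\<alpha>..\<beta>}
     (\<lambda>T. w T * (1 / ((T - u) * (T - v)) + 1 / ((T + u) * (T + v))))"

abbreviation nodes :: "real set" where
  "nodes \<equiv> {- \<alpha><..<\<alpha>}"

lemma continuous_on_ker_integrand:
  assumes "u \<in> nodes" "v \<in> nodes"
  shows "continuous_on {\<alpha>..\<beta>} (\<lambda>T. w T * (1 / ((T - u) * (T - v)) + 1 / ((T + u) * (T + v))))"
  using assms by (intro continuous_intros w_cont) auto

lemma continuous_on_ker:
  assumes "continuous_on {0..1::real} g" "\<And>t. t \<in> {0..1} \<Longrightarrow> g t \<in> nodes" "v \<in> nodes"
  shows "continuous_on {0..1} (\<lambda>t. ker (g t) v)"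
proof -
  have g: "continuous_on ({0..1} \<times> {\<alpha>..\<beta>}) (\<lambda>p. g (fst p))"
    by (rule continuous_on_compose2[OF assms(1)]) (auto intro!: continuous_intros)
  have w: "continuous_on ({0..1::real} \<times> {\<alpha>..\<beta>}) (\<lambda>p. w (snd p))"
    by (rule continuous_on_compose2[OF w_cont]) (auto intro!: continuous_intros)
  have *: "continuous_on ({0..1} \<times> {\<alpha>..\<beta>}) (\<lambda>p. w (snd p) *
      (1 / ((snd p - g (fst p)) * (snd p - v)) + 1 / ((snd p + g (fst p)) * (snd p + v))))"
    using assms(2,3) by (intro continuous_intros w g) (fastforce simp: add_eq_0_iff2)+
  have "continuous_on {0..1} (\<lambda>t. integral (cbox \<alpha> \<beta>) (\<lambda>T. w T *
      (1 / ((T - g t) * (T - v)) + 1 / ((T + g t) * (T + v)))))"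
    by (rule integral_continuous_on_param) (use * in \<open>simp add: case_prod_unfold\<close>)
  then show ?thesis by (simp add: ker_def)
qed

text \<open>
The second summand of the kernel is the first one at \<open>- T\<close>, because \<open>(T + u) * (T + v) = (- T - u) * (- T - v)\<close>.
So the measure behind the kernel lives on both sides of the interval of nodes.
\<close>

lemma bilinear_ker:
  assumes "finite I" "u ` I \<subseteq> nodes" "v ` I \<subseteq> nodes"
  shows "(\<Sum>i\<in>I. \<Sum>j\<in>I. d i * ker (u i) (v j) * c j) = integral {\<alpha>..\<beta>} (\<lambda>T. w T *
    ((\<Sum>i\<in>I. d i / (T - u i)) * (\<Sum>j\<in>I. c j / (T - v j)) +
     (\<Sum>i\<in>I. d i / (- T - u i)) * (\<Sum>j\<in>I. c j / (- T - v j))))"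
proof -
  have "d i * ker (u i) (v j) * c j = integral {\<alpha>..\<beta>} (\<lambda>T. w T *
      (d i / (T - u i) * (c j / (T - v j)) + d i / (- T - u i) * (c j / (- T - v j))))"
    if "i \<in> I" "j \<in> I" for i j
  proof -
    have "d i * ker (u i) (v j) * c j = integral {\<alpha>..\<beta>} (\<lambda>T. d i *
        (w T * (1 / ((T - u i) * (T - v j)) + 1 / ((T + u i) * (T + v j)))) * c j)"
      by (simp add: ker_def)
    also have "\<dots> = integral {\<alpha>..\<beta>} (\<lambda>T. w T *
        (d i / (T - u i) * (c j / (T - v j)) + d i / (- T - u i) * (c j / (- T - v j))))"
    proof (intro integral_cong)
      fix T :: real
      have "(- T - u i) * (- T - v j) = (T + u i) * (T + v j)" by (simp add: algebra_simps)
      then show "d i * (w T * (1 / ((T - u i) * (T - v j)) + 1 / ((T + u i) * (T + v j)))) * c j =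
        w T * (d i / (T - u i) * (c j / (T - v j)) + d i / (- T - u i) * (c j / (- T - v j)))"
        by (simp add: algebra_simps)
    qed
    finally show ?thesis .
  qed
  then have "(\<Sum>i\<in>I. \<Sum>j\<in>I. d i * ker (u i) (v j) * c j) = (\<Sum>i\<in>I. \<Sum>j\<in>I. integral {\<alpha>..\<beta>} (\<lambda>T. w T *
      (d i / (T - u i) * (c j / (T - v j)) + d i / (- T - u i) * (c j / (- T - v j)))))"
    by simp
  also have "\<dots> = integral {\<alpha>..\<beta>} (\<lambda>T. \<Sum>i\<in>I. \<Sum>j\<in>I. w T *
      (d i / (T - u i) * (c j / (T - v j)) + d i / (- T - u i) * (c j / (- T - v j))))"
  proof -
    have int: "(\<lambda>T. w T * (d i / (T - u i) * (c j / (T - v j)) + d i / (- T - u i) * (c j / (- T - v j))))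
        integrable_on {\<alpha>..\<beta>}" if "i \<in> I" "j \<in> I" for i j
    proof -
      have "u i \<in> nodes" "v j \<in> nodes" using assms that by auto
      then show ?thesis
        by (intro integrable_continuous_real continuous_intros w_cont) auto
    qed
    then show ?thesis
      using assms(1) by (simp add: integral_sum integrable_sum)
  qed
  finally show ?thesis
    by (simp add: sum_product sum_distrib_left sum.distrib algebra_simps)
qed

text \<open>
When both rational functions have the same numerator \<open>P\<close>, their product is \<open>P\<^sup>2\<close> over a product of pairs
\<open>(x - u i) * (x - v i)\<close>.  Outside the interval of nodes both members of a pair have the same sign, on the left as well as
on the right, so the integrand is nonnegative; it vanishes only at zeros of \<open>w\<close> and of \<open>P\<close>.
\<close>

lemma bilinear_ker_pos:
  assumes "finite I" "u ` I \<subseteq> nodes" "v ` I \<subseteq> nodes" "P \<noteq> 0"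
    and d: "\<And>x. x \<notin> u ` I \<Longrightarrow> (\<Sum>i\<in>I. d i / (x - u i)) = poly P x / (\<Prod>i\<in>I. x - u i)"
    and c: "\<And>x. x \<notin> v ` I \<Longrightarrow> (\<Sum>i\<in>I. c i / (x - v i)) = poly P x / (\<Prod>i\<in>I. x - v i)"
  shows "(\<Sum>i\<in>I. \<Sum>j\<in>I. d i * ker (u i) (v j) * c j) > 0"
proof -
  let ?F = "\<lambda>x. (\<Sum>i\<in>I. d i / (x - u i)) * (\<Sum>j\<in>I. c j / (x - v j))"
  have F: "?F x = (poly P x)\<^sup>2 / (\<Prod>i\<in>I. (x - u i) * (x - v i))"
    and prod_pos: "(\<Prod>i\<in>I. (x - u i) * (x - v i)) > 0" if "\<alpha> \<le> \<bar>x\<bar>" for x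
  proof -
    have "x \<notin> u ` I" "x \<notin> v ` I" using that assms by force+
    then show "?F x = (poly P x)\<^sup>2 / (\<Prod>i\<in>I. (x - u i) * (x - v i))"
      by (simp add: d c prod.distrib power2_eq_square)
    show "(\<Prod>i\<in>I. (x - u i) * (x - v i)) > 0"
    proof (intro prod_pos ballI)
      fix i assume "i \<in> I"
      then have "u i \<in> nodes" "v i \<in> nodes" using assms by auto
      then show "(x - u i) * (x - v i) > 0"
        using that by (cases "x > 0") (auto intro: mult_neg_neg)
    qed
  qed
  have F_nonneg: "?F x \<ge> 0" if "\<alpha> \<le> \<bar>x\<bar>" for x
    using prod_pos[OF that] unfolding F[OF that] by simp
  define f where "f T = w T * (?F T + ?F (- T))" for T
  have f_nonneg: "f T \<ge> 0" if "T \<in> {\<alpha>..\<beta>}" for T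
    unfolding f_def using that less by (intro mult_nonneg_nonneg add_nonneg_nonneg w_nonneg F_nonneg) auto
  have f_cont: "continuous_on {\<alpha>..\<beta>} f"
    unfolding f_def using assms(2,3) by (intro continuous_intros w_cont) (force simp: image_subset_iff)+
  have "\<exists>T\<in>{\<alpha>..\<beta>}. f T \<noteq> 0"
  proof (rule ccontr)
    assume none: "\<not> (\<exists>T\<in>{\<alpha>..\<beta>}. f T \<noteq> 0)"
    have "{\<alpha>..\<beta>} \<subseteq> {T \<in> {\<alpha>..\<beta>}. w T = 0} \<union> {T. poly P T = 0}"
    proof
      fix T assume T: "T \<in> {\<alpha>..\<beta>}"
      with none have "w T = 0 \<or> ?F T + ?F (- T) = 0" by (auto simp: f_def)
      moreover have "?F T \<ge> 0" "?F (- T) \<ge> 0" using T less by (auto intro!: F_nonneg)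
      ultimately have "w T = 0 \<or> ?F T = 0" by linarith
      then show "T \<in> {T \<in> {\<alpha>..\<beta>}. w T = 0} \<union> {T. poly P T = 0}"
        using T less F[of T] prod_pos[of T] by auto
    qed
    moreover have "countable ({T \<in> {\<alpha>..\<beta>}. w T = 0} \<union> {T. poly P T = 0})"
      using w_zeros poly_roots_finite[OF assms(4)] by (simp add: countable_finite)
    ultimately have "countable {\<alpha>..\<beta>}" by (rule countable_subset)
    then show False using uncountable_closed_interval less by blast
  qed
  then have "integral {\<alpha>..\<beta>} f \<noteq> 0"
    using integral_eq_0_iff[OF f_cont less(2) f_nonneg] by blast
  moreover have "integral {\<alpha>..\<beta>} f \<ge> 0"
    by (intro integral_nonneg integrable_continuous_real f_cont f_nonneg)
  ultimately have "integral {\<alpha>..\<beta>} f > 0" by simp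
  then show ?thesis using bilinear_ker[OF assms(1-3), of d c] by (simp add: f_def[abs_def])
qed

lemma ker_pos_def:
  assumes "finite I" "inj_on u I" "u ` I \<subseteq> nodes" "k \<in> I" "c k \<noteq> 0"
  shows "(\<Sum>i\<in>I. \<Sum>j\<in>I. c i * ker (u i) (u j) * c j) > 0"
proof -
  obtain d P where "P \<noteq> 0" "\<And>x. x \<notin> u ` I \<Longrightarrow> (\<Sum>i\<in>I. c i / (x - u i)) = poly P x / (\<Prod>i\<in>I. x - u i)"
    using exists_partial_fraction_same_numerator[where u = u and v = u and I = I and c = c] assms(1,2,4,5) by metis
  then show ?thesis using assms by (intro bilinear_ker_pos) auto
qed

text \<open>
Move the nodes \<open>u\<close> to the nodes \<open>v\<close> along straight lines.  They stay increasing, hence distinct, so the matrix stays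
nonsingular, and it ends at a positive definite one.
\<close>

theorem ker_strictly_totally_positive:
  assumes u: "strict_mono_on {..<k} u" "u ` {..<k} \<subseteq> nodes"
    and v: "strict_mono_on {..<k} v" "v ` {..<k} \<subseteq> nodes"
  shows "Determinant.det (Matrix.mat k k (\<lambda>(i, j). ker (u i) (v j))) > 0"
proof -
  define g where "g t i = (1 - t) * u i + t * v i" for t :: real and i :: nat
  have g_mono: "strict_mono_on {..<k} (g t)" if "t \<in> {0..1}" for t
  proof (rule strict_mono_onI)
    fix i j assume ij: "i \<in> {..<k}" "j \<in> {..<k}" "i < j"
    have "u i < u j" "v i < v j" using ij strict_mono_onD[OF u(1), of i j] strict_mono_onD[OF v(1), of i j] by auto
    then show "g t i < g t j" unfolding g_def using that
      by (cases "t = 0") (auto intro!: add_le_less_mono mult_left_mono)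
  qed
  have g_node: "g t i \<in> nodes" if "t \<in> {0..1}" "i < k" for t i
  proof -
    have "u i \<in> nodes" "v i \<in> nodes" using u v that by auto
    then have "(1 - t) *\<^sub>R u i + t *\<^sub>R v i \<in> nodes"
      using that by (intro convexD_alt) auto
    then show ?thesis by (simp add: g_def)
  qed
  have "Determinant.det (Matrix.mat k k (\<lambda>(i, j). ker (g 0 i) (v j))) > 0"
  proof (rule det_pos_homotopy[of k "\<lambda>t i j. ker (g t i) (v j)"])
    fix i j assume "i < k" "j < k"
    then show "continuous_on {0..1} (\<lambda>t. ker (g t i) (v j))"
      using v(2) by (intro continuous_on_ker g_node) (auto simp: g_def intro!: continuous_intros)
  next
    fix t :: real assume t: "t \<in> {0..1}"
    show "Determinant.det (Matrix.mat k k (\<lambda>(i, j). ker (g t i) (v j))) \<noteq> 0"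
    proof (rule det_ne_0_if_bilinear_pos)
      fix c :: "nat \<Rightarrow> real" and i assume i: "i < k" "c i \<noteq> 0"
      have inj: "inj_on (g t) {..<k}" "inj_on v {..<k}"
        using g_mono[OF t] v(1) by (auto intro: strict_mono_on_imp_inj_on)
      have sub: "g t ` {..<k} \<subseteq> nodes" using g_node[OF t] by blast
      obtain d P where "P \<noteq> 0"
        "\<And>x. x \<notin> g t ` {..<k} \<Longrightarrow> (\<Sum>i<k. d i / (x - g t i)) = poly P x / (\<Prod>i<k. x - g t i)"
        "\<And>x. x \<notin> v ` {..<k} \<Longrightarrow> (\<Sum>i<k. c i / (x - v i)) = poly P x / (\<Prod>i<k. x - v i)"
        by (rule exists_partial_fraction_same_numerator[OF finite_lessThan inj, of i c])
          (use i in simp, use i in simp, rule that)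
      then show "\<exists>d. (\<Sum>i<k. \<Sum>j<k. d i * ker (g t i) (v j) * c j) > 0"
        using bilinear_ker_pos[OF finite_lessThan sub v(2)] by blast
    qed
  next
    have "inj_on v {..<k}" using v(1) by (rule strict_mono_on_imp_inj_on)
    then have "(\<Sum>i<k. \<Sum>j<k. c i * ker (v i) (v j) * c j) > 0" if "i < k" "c i \<noteq> 0" for c i
      using that v(2) by (intro ker_pos_def) auto
    then have "Determinant.det (Matrix.mat k k (\<lambda>(i, j). ker (v i) (v j))) > 0"
      by (rule det_pos_if_pos_def)
    then show "Determinant.det (Matrix.mat k k (\<lambda>(i, j). ker (g 1 i) (v j))) > 0"
      by (simp add: g_def)
  qed
  then show ?thesis by (simp add: g_def)
qed

end

section \<open>The sine-cosine kernel and its divided differences\<close>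

text \<open>
By \<open>sin_times_cos\<close> the integrand is half a sum of two sines, whose primitives are the two fractions in \<open>F\<close>.
\<close>

lemma S_ker_closed_form:
  assumes "L > 0" "\<alpha> = 2 * pi * x / L" "\<alpha>\<^sup>2 \<noteq> r\<^sup>2"
  shows "S_ker r x L = (cos (2 * pi * x) - cos (r * L)) / 2 * (1 / (r - \<alpha>) - 1 / (r + \<alpha>))"
proof -
  have ne: "\<alpha> - r \<noteq> 0" "\<alpha> + r \<noteq> 0"
    using assms(3) by (auto simp: power2_eq_square add_eq_0_iff2)
  define F where "F y = (cos (\<alpha> * L - (\<alpha> - r) * y) / (\<alpha> - r) + cos (\<alpha> * L - (\<alpha> + r) * y) / (\<alpha> + r)) / 2" for y
  have F: "(F has_vector_derivative sin (2 * pi * x * (1 - y / L)) * cos (r * y)) (at y within {0..L})" for y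
  proof -
    have "2 * pi * x * (1 - y / L) = \<alpha> * (L - y)"
      using assms(1,2) by (simp add: field_simps)
    then have "sin (2 * pi * x * (1 - y / L)) * cos (r * y) =
        (sin (\<alpha> * (L - y) + r * y) + sin (\<alpha> * (L - y) - r * y)) / 2"
      by (simp only: sin_times_cos)
    moreover have "\<alpha> * (L - y) + r * y = \<alpha> * L - (\<alpha> - r) * y"
      "\<alpha> * (L - y) - r * y = \<alpha> * L - (\<alpha> + r) * y"
      by (simp_all add: algebra_simps)
    moreover have "((\<lambda>y. cos (a - b * y) / b) has_real_derivative sin (a - b * y)) (at y within {0..L})"
      if "b \<noteq> 0" for a b
      using that by (auto intro!: derivative_eq_intros)
    from DERIV_cdivide[OF DERIV_add[OF this[OF ne(1)] this[OF ne(2)]]]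
    have "(F has_real_derivative
        (sin (\<alpha> * L - (\<alpha> - r) * y) + sin (\<alpha> * L - (\<alpha> + r) * y)) / 2) (at y within {0..L})"
      unfolding F_def .
    ultimately show ?thesis
      by (simp only: has_real_derivative_iff_has_vector_derivative)
  qed
  have "((\<lambda>y. sin (2 * pi * x * (1 - y / L)) * cos (r * y)) has_integral F L - F 0) {0..L}"
    using assms(1) by (intro fundamental_theorem_of_calculus F) auto
  then have S: "S_ker r x L = F L - F 0"
    unfolding S_ker_def by (rule integral_unique)
  define P Q where "P = 1 / (r - \<alpha>)" and "Q = 1 / (r + \<alpha>)"
  have div: "t / (\<alpha> - r) = - (t * P)" "t / (\<alpha> + r) = t * Q" for t
    using minus_divide_right[of t "r - \<alpha>"] by (simp_all add: P_def Q_def add.commute)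
  have args: "\<alpha> * L - (\<alpha> - r) * L = r * L" "\<alpha> * L - (\<alpha> + r) * L = - (r * L)"
      "\<alpha> * L - (\<alpha> - r) * 0 = 2 * pi * x" "\<alpha> * L - (\<alpha> + r) * 0 = 2 * pi * x"
    using assms by (simp_all add: algebra_simps)
  show ?thesis
    unfolding S F_def args div P_def[symmetric] Q_def[symmetric] cos_minus
    by (simp add: algebra_simps diff_divide_distrib add_divide_distrib)
qed

text \<open>
The derivative of \<open>S_ker r x L\<close> in \<open>x\<close>, taken under the integral sign.  Unlike the closed form it has no exceptional points
\<open>r = \<plusminus> 2 * pi * x / L\<close>, so it can be integrated over all frequencies.
\<close>

definition S_ker_deriv :: "real \<Rightarrow> real \<Rightarrow> real \<Rightarrow> real" where
  "S_ker_deriv r x L =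
     integral {0..L} (\<lambda>y. cos (2 * pi * x * (1 - y / L)) * (2 * pi * (1 - y / L)) * cos (r * y))"

lemma has_real_derivative_S_ker:
  assumes "L > 0"
  shows "((\<lambda>x. S_ker r x L) has_real_derivative S_ker_deriv r x L) (at x)"
proof -
  have "((\<lambda>x. integral (cbox 0 L) (\<lambda>y. sin (2 * pi * x * (1 - y / L)) * cos (r * y)))
      has_real_derivative
      integral (cbox 0 L) (\<lambda>y. cos (2 * pi * x * (1 - y / L)) * (2 * pi * (1 - y / L)) * cos (r * y)))
      (at x within UNIV)"
  proof (rule leibniz_rule_field_derivative)
    fix x y :: real
    show "((\<lambda>x. sin (2 * pi * x * (1 - y / L)) * cos (r * y)) has_real_derivative
        cos (2 * pi * x * (1 - y / L)) * (2 * pi * (1 - y / L)) * cos (r * y)) (at x within UNIV)"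
      by (auto intro!: derivative_eq_intros)
    show "(\<lambda>y. sin (2 * pi * x * (1 - y / L)) * cos (r * y)) integrable_on cbox 0 L"
      using assms by (intro integrable_continuous continuous_intros) auto
  qed (use assms in \<open>auto simp: case_prod_unfold intro!: continuous_intros\<close>)
  then show ?thesis by (simp add: S_ker_def S_ker_deriv_def)
qed

lemma continuous_on_S_ker [continuous_intros]:
  assumes "L > 0" "continuous_on A f" "continuous_on A g"
  shows "continuous_on A (\<lambda>a. S_ker (f a) (g a) L)"
proof -
  have "continuous_on UNIV (\<lambda>p. integral (cbox 0 L)
      (\<lambda>y. sin (2 * pi * snd p * (1 - y / L)) * cos (fst p * y)))"
    using assms(1) by (intro integral_continuous_on_param) (auto simp: case_prod_unfold intro!: continuous_intros)
  then have "continuous_on UNIV (\<lambda>p. S_ker (fst p) (snd p) L)"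
    by (simp add: S_ker_def)
  from continuous_on_compose2[OF this continuous_on_Pair[OF assms(2,3)]] show ?thesis by simp
qed

lemma continuous_on_S_ker_deriv [continuous_intros]:
  assumes "L > 0" "continuous_on A f" "continuous_on A g"
  shows "continuous_on A (\<lambda>a. S_ker_deriv (f a) (g a) L)"
proof -
  have "continuous_on UNIV (\<lambda>p. integral (cbox 0 L)
      (\<lambda>y. cos (2 * pi * snd p * (1 - y / L)) * (2 * pi * (1 - y / L)) * cos (fst p * y)))"
    using assms(1) by (intro integral_continuous_on_param) (auto simp: case_prod_unfold intro!: continuous_intros)
  then have "continuous_on UNIV (\<lambda>p. S_ker_deriv (fst p) (snd p) L)"
    by (simp add: S_ker_deriv_def)
  from continuous_on_compose2[OF this continuous_on_Pair[OF assms(2,3)]] show ?thesis by simp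
qed

lemma has_real_derivative_psi_arch:
  assumes "L > 0"
  shows "(psi_arch L T has_real_derivative
    1 / (2 * pi\<^sup>2) * integral {- T..T} (\<lambda>r. h_plus r * S_ker_deriv r x L)) (at x)"
proof -
  have "((\<lambda>x. integral (cbox (- T) T) (\<lambda>r. h_plus r * S_ker r x L)) has_real_derivative
      integral (cbox (- T) T) (\<lambda>r. h_plus r * S_ker_deriv r x L)) (at x within UNIV)"
  proof (rule leibniz_rule_field_derivative)
    fix x r :: real
    show "((\<lambda>x. h_plus r * S_ker r x L) has_real_derivative h_plus r * S_ker_deriv r x L) (at x within UNIV)"
      by (intro DERIV_cmult has_real_derivative_S_ker assms)
    show "(\<lambda>r. h_plus r * S_ker r x L) integrable_on cbox (- T) T"
      using assms by (intro integrable_continuous continuous_intros continuous_on_h_plus)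
  next
    have "continuous_on (UNIV \<times> cbox (- T) T) (\<lambda>p. h_plus (snd p) * S_ker_deriv (snd p) (fst p) L)"
      by (intro continuous_on_mult continuous_on_compose2[OF continuous_on_h_plus[of UNIV]])
        (auto intro!: continuous_intros assms)
    then show "continuous_on (UNIV \<times> cbox (- T) T) (\<lambda>(x, r). h_plus r * S_ker_deriv r x L)"
      by (simp add: case_prod_unfold)
  qed auto
  then show ?thesis
    unfolding psi_arch_def[abs_def] by (intro DERIV_cmult) simp
qed

text \<open>
Divided differences and derivatives are linear in the function, so \<open>Q_arch\<close> is, up to a constant, the integral of these
matrices over the frequencies with weight \<open>h_plus\<close>.
\<close>

definition S_quot :: "real \<Rightarrow> real \<Rightarrow> int \<Rightarrow> int \<Rightarrow> real" where
  "S_quot L r m n = Qmat (\<lambda>x. S_ker r x L) m n"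

lemma S_quot_eq:
  assumes "L > 0"
  shows "S_quot L r m n = (if m = n then S_ker_deriv r m L
    else (S_ker r m L - S_ker r n L) / (real_of_int m - real_of_int n))"
  unfolding S_quot_def Qmat_def
  using DERIV_imp_deriv[OF has_real_derivative_S_ker[OF assms]] by simp

lemma continuous_on_S_quot:
  assumes "L > 0"
  shows "continuous_on A (\<lambda>r. S_quot L r m n)"
  unfolding S_quot_eq[OF assms]
  by (cases "m = n") (auto intro!: continuous_intros assms)

lemma S_quot_minus [simp]: "S_quot L (- r) m n = S_quot L r m n"
  by (simp add: S_quot_def Qmat_def S_ker_def)

lemma Q_arch_eq_integral:
  assumes "L > 0"
  shows "Q_arch L T m n = 1 / (2 * pi\<^sup>2) * integral {- T..T} (\<lambda>r. h_plus r * S_quot L r m n)"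
proof (cases "m = n")
  case True
  then show ?thesis
    using DERIV_imp_deriv[OF has_real_derivative_psi_arch[OF assms]]
    by (simp add: Q_arch_def Qmat_def S_quot_eq[OF assms])
next
  case False
  let ?I = "\<lambda>f. integral {- T..T} (\<lambda>r. h_plus r * f r)"
  have "?I (\<lambda>r. S_ker r m L) - ?I (\<lambda>r. S_ker r n L) =
      integral {- T..T} (\<lambda>r. h_plus r * S_ker r m L - h_plus r * S_ker r n L)"
    by (intro integral_diff[symmetric] integrable_continuous_real continuous_intros
        continuous_on_h_plus assms)
  also have "\<dots> = integral {- T..T} (\<lambda>r. (real_of_int m - real_of_int n) * (h_plus r * S_quot L r m n))"
  proof (intro integral_cong)
    fix r
    have "(real_of_int m - real_of_int n) * S_quot L r m n = S_ker r m L - S_ker r n L"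
      using False by (simp add: S_quot_eq[OF assms])
    then show "h_plus r * S_ker r m L - h_plus r * S_ker r n L =
        (real_of_int m - real_of_int n) * (h_plus r * S_quot L r m n)"
      by (metis mult.left_commute right_diff_distrib)
  qed
  finally have "(?I (\<lambda>r. S_ker r m L) - ?I (\<lambda>r. S_ker r n L)) / (real_of_int m - real_of_int n) =
      ?I (\<lambda>r. S_quot L r m n)"
    using False by simp
  then show ?thesis
    using False by (simp only: Q_arch_def Qmat_def psi_arch_def if_False
        right_diff_distrib[symmetric] times_divide_eq_right[symmetric])
qed

lemma integral_even_symmetric_diff:
  fixes f :: "real \<Rightarrow> real"
  assumes "continuous_on UNIV f" "\<And>x. f (- x) = f x" "0 \<le> a" "a \<le> b"
  shows "integral {- b..b} f - integral {- a..a} f = 2 * integral {a..b} f"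
proof -
  have int: "f integrable_on {c..d}" for c d
    by (intro integrable_continuous_real continuous_on_subset[OF assms(1)]) auto
  have "integral {- b..- a} f + integral {- a..b} f = integral {- b..b} f"
    using assms(3,4) by (intro Henstock_Kurzweil_Integration.integral_combine int) auto
  moreover have "integral {- a..a} f + integral {a..b} f = integral {- a..b} f"
    using assms(3,4) by (intro Henstock_Kurzweil_Integration.integral_combine int) auto
  moreover have "integral {- b..- a} f = integral {a..b} f"
    using Henstock_Kurzweil_Integration.integral_reflect_real[of b a f] assms(2) by simp
  ultimately show ?thesis by simp
qed

lemma outer_sum_eq:
  assumes "\<rho> > 0"
  shows "outer (p_vec \<rho> T) (p_vec \<rho> T) m n + outer (q_vec \<rho> T) (q_vec \<rho> T) m n =
    \<rho> * \<rho> * (1 / ((T - \<rho> * m) * (T - \<rho> * n)) + 1 / ((T + \<rho> * m) * (T + \<rho> * n)))"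
proof -
  have "1 / (T / \<rho> - x) = \<rho> / (T - \<rho> * x)" "1 / (T / \<rho> + x) = \<rho> / (T + \<rho> * x)" for x
    using assms by (simp_all add: field_simps)
  then show ?thesis by (simp add: outer_def p_vec_def q_vec_def distrib_left)
qed

lemma one_minus_cos_eq: "1 - cos (r * L :: real) = 2 * (sin (L * r / 2))\<^sup>2"
  using cos_double_sin[of "L * r / 2"] by (simp add: mult.commute)

text \<open>
At an integer \<open>k\<close> the closed form becomes \<open>sin\<^sup>2 (L * r / 2) * (1 / (r - \<rho> * k) - 1 / (r + \<rho> * k))\<close>, and the divided difference of
\<open>1 / (r - x)\<close> at \<open>x, y\<close> is \<open>1 / ((r - x) * (r - y))\<close>.  For \<open>m = n\<close> the closed form, which is valid near \<open>m\<close>, is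
differentiated; the term with the derivative of \<open>cos (2 * pi * x)\<close> drops out at integers.
\<close>

lemma S_quot_eq_rank_two:
  assumes "L > 0" and \<rho>: "\<rho> = 2 * pi / L"
    and m: "\<rho> * \<bar>real_of_int m\<bar> < r" and n: "\<rho> * \<bar>real_of_int n\<bar> < r"
  shows "S_quot L r m n = (sin (L * r / 2))\<^sup>2 / \<rho> *
    (outer (p_vec \<rho> r) (p_vec \<rho> r) m n + outer (q_vec \<rho> r) (q_vec \<rho> r) m n)"
proof -
  have \<rho>_pos: "\<rho> > 0" using assms by simp
  define s where "s = (sin (L * r / 2))\<^sup>2"
  have s: "(1 - cos (r * L)) / 2 = s"
    by (simp add: s_def one_minus_cos_eq)
  have abs_less: "\<bar>\<rho> * real_of_int k\<bar> < r" if "\<rho> * \<bar>real_of_int k\<bar> < r" for k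
    using that \<rho>_pos by (simp add: abs_mult)
  have nz: "r - \<rho> * m > 0" "r + \<rho> * m > 0" "r - \<rho> * n > 0" "r + \<rho> * n > 0"
    using abs_less[OF m] abs_less[OF n] by linarith+
  have S: "S_ker r x L = (cos (2 * pi * x) - cos (r * L)) / 2 * (1 / (r - \<rho> * x) - 1 / (r + \<rho> * x))"
    if "\<bar>\<rho> * x\<bar> < r" for x
  proof -
    have "(\<rho> * x)\<^sup>2 \<noteq> r\<^sup>2" using that by (auto simp: power2_eq_iff)
    then show ?thesis using assms(1) by (intro S_ker_closed_form) (auto simp: \<rho>)
  qed
  have S_int: "S_ker r k L = s * (1 / (r - \<rho> * k) - 1 / (r + \<rho> * k))"
    if "\<rho> * \<bar>real_of_int k\<bar> < r" for k :: int
  proof -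
    have "cos (2 * pi * real_of_int k) = 1" by (simp add: cos_int_2pin)
    then show ?thesis by (simp only: S[OF abs_less[OF that]] s)
  qed
  have pq: "s / \<rho> * (outer (p_vec \<rho> r) (p_vec \<rho> r) m n + outer (q_vec \<rho> r) (q_vec \<rho> r) m n) =
      s * (\<rho> / ((r - \<rho> * m) * (r - \<rho> * n)) + \<rho> / ((r + \<rho> * m) * (r + \<rho> * n)))"
    unfolding outer_sum_eq[OF \<rho>_pos] using \<rho>_pos by (simp add: distrib_left)
  show ?thesis
  proof (cases "m = n")
    case False
    have "1 / (r - \<rho> * m) - 1 / (r - \<rho> * n) = (m - n) * (\<rho> / ((r - \<rho> * m) * (r - \<rho> * n)))"
      "1 / (r + \<rho> * n) - 1 / (r + \<rho> * m) = (m - n) * (\<rho> / ((r + \<rho> * m) * (r + \<rho> * n)))"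
      using nz by (simp_all add: divide_simps) (simp_all add: algebra_simps)
    then have "S_ker r m L - S_ker r n L =
        (m - n) * (s * (\<rho> / ((r - \<rho> * m) * (r - \<rho> * n)) + \<rho> / ((r + \<rho> * m) * (r + \<rho> * n))))"
      unfolding S_int[OF m] S_int[OF n] by (simp add: algebra_simps)
    then show ?thesis
      using False unfolding S_quot_eq[OF assms(1)] s_def[symmetric] pq by simp
  next
    case True
    let ?f = "\<lambda>x. (cos (2 * pi * x) - cos (r * L)) / 2 * (1 / (r - \<rho> * x) - 1 / (r + \<rho> * x))"
    let ?D = "s * (\<rho> / (r - \<rho> * m)\<^sup>2 + \<rho> / (r + \<rho> * m)\<^sup>2)"
    have df: "(?f has_real_derivative
        - (sin (2 * pi * m) * (2 * pi)) / 2 * (1 / (r - \<rho> * m) - 1 / (r + \<rho> * m)) +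
        (\<rho> / (r - \<rho> * m)\<^sup>2 + \<rho> / (r + \<rho> * m)\<^sup>2) * ((cos (2 * pi * m) - cos (r * L)) / 2)) (at m)"
      using nz by (auto intro!: derivative_eq_intros simp: power2_eq_square)
    have "sin (2 * pi * m) = 0" "cos (2 * pi * m) = 1"
      by (simp_all add: sin_int_2pin cos_int_2pin)
    then have f: "(?f has_real_derivative ?D) (at m)"
      by (intro DERIV_cong[OF df]) (simp only: s; simp)
    have "\<forall>\<^sub>F x in nhds (real_of_int m). \<bar>\<rho> * x\<bar> < r"
    proof -
      have "((\<lambda>x. \<bar>\<rho> * x\<bar>) \<longlongrightarrow> \<bar>\<rho> * m\<bar>) (nhds (real_of_int m))"
        by (intro tendsto_intros filterlim_ident)
      then show ?thesis using abs_less[OF m] by (rule order_tendstoD(2))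
    qed
    then have "\<forall>\<^sub>F x in nhds (real_of_int m). S_ker r x L = ?f x"
      by eventually_elim (rule S)
    then have "((\<lambda>x. S_ker r x L) has_real_derivative ?D) (at m)"
      using f by (subst DERIV_cong_ev[OF refl _ refl])
    from DERIV_unique[OF has_real_derivative_S_ker[OF assms(1)] this]
    show ?thesis
      using True unfolding S_quot_eq[OF assms(1)] s_def[symmetric] pq by (simp add: power2_eq_square)
  qed
qed

section \<open>The truncated archimedean matrices\<close>

lemma Delta_arch_eq_integral:
  assumes "L > 0" and \<rho>: "\<rho> = 2 * pi / L"
    and m: "\<rho> * \<bar>real_of_int m\<bar> < T\<^sub>1" and n: "\<rho> * \<bar>real_of_int n\<bar> < T\<^sub>1" and T: "T\<^sub>1 \<le> T\<^sub>2"
  shows "Delta_arch L T\<^sub>1 T\<^sub>2 m n = 1 / pi\<^sup>2 * integral {T\<^sub>1..T\<^sub>2}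
    (\<lambda>T. h_plus T * ((sin (L * T / 2))\<^sup>2 / \<rho>) *
      (outer (p_vec \<rho> T) (p_vec \<rho> T) m n + outer (q_vec \<rho> T) (q_vec \<rho> T) m n))"
proof -
  let ?f = "\<lambda>r. h_plus r * S_quot L r m n"
  have "\<rho> > 0" using assms by simp
  then have "0 \<le> \<rho> * \<bar>real_of_int m\<bar>" by simp
  then have "T\<^sub>1 \<ge> 0" using m by linarith
  have "Delta_arch L T\<^sub>1 T\<^sub>2 m n =
      1 / (2 * pi\<^sup>2) * (integral {- T\<^sub>2..T\<^sub>2} ?f - integral {- T\<^sub>1..T\<^sub>1} ?f)"
    by (simp add: Delta_arch_def Q_arch_eq_integral[OF assms(1)] right_diff_distrib)
  also have "integral {- T\<^sub>2..T\<^sub>2} ?f - integral {- T\<^sub>1..T\<^sub>1} ?f = 2 * integral {T\<^sub>1..T\<^sub>2} ?f"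
    using \<open>T\<^sub>1 \<ge> 0\<close> T
    by (intro integral_even_symmetric_diff continuous_on_mult continuous_on_h_plus continuous_on_S_quot assms(1)) auto
  also have "integral {T\<^sub>1..T\<^sub>2} ?f = integral {T\<^sub>1..T\<^sub>2}
    (\<lambda>T. h_plus T * ((sin (L * T / 2))\<^sup>2 / \<rho>) *
      (outer (p_vec \<rho> T) (p_vec \<rho> T) m n + outer (q_vec \<rho> T) (q_vec \<rho> T) m n))"
  proof (intro integral_cong)
    fix T assume "T \<in> {T\<^sub>1..T\<^sub>2}"
    then have "S_quot L T m n = (sin (L * T / 2))\<^sup>2 / \<rho> *
        (outer (p_vec \<rho> T) (p_vec \<rho> T) m n + outer (q_vec \<rho> T) (q_vec \<rho> T) m n)"
      using m n by (intro S_quot_eq_rank_two assms(1) \<rho>) auto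
    then show "h_plus T * S_quot L T m n = h_plus T * ((sin (L * T / 2))\<^sup>2 / \<rho>) *
        (outer (p_vec \<rho> T) (p_vec \<rho> T) m n + outer (q_vec \<rho> T) (q_vec \<rho> T) m n)"
      by (simp only: mult.assoc)
  qed
  finally show ?thesis by simp
qed

lemma countable_zeros_sin_mult:
  fixes a :: real
  assumes "a \<noteq> 0"
  shows "countable {x. sin (a * x) = 0}"
proof -
  have "{x. sin (a * x) = 0} \<subseteq> range (\<lambda>i::int. real_of_int i * pi / a)"
  proof clarify
    fix x assume "sin (a * x) = 0"
    then obtain i :: int where "a * x = of_int i * pi" by (auto simp: sin_zero_iff_int2)
    then have "x = of_int i * pi / a" using assms by (simp add: field_simps)
    then show "x \<in> range (\<lambda>i::int. real_of_int i * pi / a)" by blast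
  qed
  then show ?thesis by (rule countable_subset) simp
qed

text \<open>
The factor \<open>1 / \<rho>\<close> of the representation becomes \<open>\<rho>\<close> here, because in the variable \<open>T\<close> itself the entries of \<open>p_vec\<close> and
\<open>q_vec\<close> are \<open>\<rho> / (T - \<rho> * n)\<close> and \<open>\<rho> / (T + \<rho> * n)\<close>.
\<close>

definition arch_weight :: "real \<Rightarrow> real \<Rightarrow> real \<Rightarrow> real" where
  "arch_weight L \<rho> T = h_plus T * (sin (L * T / 2))\<^sup>2 * \<rho> / pi\<^sup>2"

lemma weighted_kernel_arch_weight:
  assumes "L > 0" "\<rho> > 0" "T\<^sub>1 \<ge> 7" "T\<^sub>1 < T\<^sub>2"
  shows "weighted_kernel (arch_weight L \<rho>) T\<^sub>1 T\<^sub>2"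
proof
  show "continuous_on {T\<^sub>1..T\<^sub>2} (arch_weight L \<rho>)"
    unfolding arch_weight_def by (intro continuous_intros continuous_on_h_plus) auto
  show "0 \<le> arch_weight L \<rho> T" if "T \<in> {T\<^sub>1..T\<^sub>2}" for T
    using h_plus_pos[of T] that assms by (simp add: arch_weight_def)
  have "{T \<in> {T\<^sub>1..T\<^sub>2}. arch_weight L \<rho> T = 0} \<subseteq> {T. sin (L / 2 * T) = 0}"
  proof clarify
    fix T assume "T \<in> {T\<^sub>1..T\<^sub>2}" "arch_weight L \<rho> T = 0"
    then show "sin (L / 2 * T) = 0"
      using h_plus_pos[of T] assms by (simp add: arch_weight_def)
  qed
  then show "countable {T \<in> {T\<^sub>1..T\<^sub>2}. arch_weight L \<rho> T = 0}"
    by (rule countable_subset) (use assms in \<open>intro countable_zeros_sin_mult; simp\<close>)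
qed (use assms in auto)

lemma arch_weight_times_kernel:
  assumes "\<rho> > 0"
  shows "arch_weight L \<rho> T * (1 / ((T - \<rho> * m) * (T - \<rho> * n)) + 1 / ((T + \<rho> * m) * (T + \<rho> * n))) =
    1 / pi\<^sup>2 * (h_plus T * ((sin (L * T / 2))\<^sup>2 / \<rho>) *
      (outer (p_vec \<rho> T) (p_vec \<rho> T) m n + outer (q_vec \<rho> T) (q_vec \<rho> T) m n))"
  unfolding outer_sum_eq[OF assms] using assms by (simp add: arch_weight_def)

text \<open>
For a symmetric real matrix the Hermitian form at \<open>x\<close> is the sum of the real quadratic forms at the real and the imaginary
part of \<open>x\<close>, because the cross terms cancel.
\<close>

lemma complex_pos_def_on_of_real:
  assumes "finite I" and sym: "\<And>m n. m \<in> I \<Longrightarrow> n \<in> I \<Longrightarrow> A m n = A n m"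
    and pd: "\<And>x :: int \<Rightarrow> real. \<And>k. k \<in> I \<Longrightarrow> x k \<noteq> 0 \<Longrightarrow> (\<Sum>m\<in>I. \<Sum>n\<in>I. x m * A m n * x n) > 0"
  shows "complex_pos_def_on I (\<lambda>m n. complex_of_real (A m n))"
  unfolding complex_pos_def_on_def
proof (intro conjI ballI allI impI)
  fix m n assume "m \<in> I" "n \<in> I"
  then show "complex_of_real (A n m) = cnj (complex_of_real (A m n))"
    by (simp add: sym)
next
  fix x :: "int \<Rightarrow> complex" assume "\<exists>k\<in>I. x k \<noteq> 0"
  then obtain k where k: "k \<in> I" "x k \<noteq> 0" by blast
  let ?q = "\<lambda>x. \<Sum>m\<in>I. \<Sum>n\<in>I. x m * A m n * x n :: real"
  let ?S = "\<Sum>m\<in>I. \<Sum>n\<in>I. cnj (x m) * complex_of_real (A m n) * x n"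
  have Re_S: "Re ?S = ?q (\<lambda>i. Re (x i)) + ?q (\<lambda>i. Im (x i))"
    by (simp add: sum.distrib[symmetric] algebra_simps)
  have nonneg: "?q y \<ge> 0" for y :: "int \<Rightarrow> real"
  proof (cases "\<exists>k\<in>I. y k \<noteq> 0")
    case True
    then show ?thesis using pd[of _ y] by (auto intro: less_imp_le)
  qed simp
  have "?q (\<lambda>i. Re (x i)) > 0 \<or> ?q (\<lambda>i. Im (x i)) > 0"
    using k pd[of k "\<lambda>i. Re (x i)"] pd[of k "\<lambda>i. Im (x i)"] by (auto simp: complex_eq_iff)
  then show "Re ?S > 0"
    unfolding Re_S using nonneg[of "\<lambda>i. Re (x i)"] nonneg[of "\<lambda>i. Im (x i)"] by linarith
  have "cnj ?S = (\<Sum>m\<in>I. \<Sum>n\<in>I. cnj (x n) * complex_of_real (A n m) * x m)"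
    by (auto simp: sym intro!: sum.cong)
  also have "\<dots> = ?S" by (rule sum.swap)
  finally show "?S \<in> \<real>" by (simp add: Reals_cnj_iff)
qed

theorem theorem3p2:
  fixes c L \<rho> T\<^sub>1 T\<^sub>2 :: real and N :: nat
  assumes "c > 1"
    and "L = ln c"
    and "\<rho> = 2 * pi / L"
    and "T\<^sub>1 > max (\<rho> * real N) 7"
    and "T\<^sub>2 > T\<^sub>1"
  shows
    "(\<forall>m\<in>idx N. \<forall>n\<in>idx N.
        (\<lambda>T. h_plus T * ((sin (L * T / 2))\<^sup>2 / \<rho>) *
             (outer (p_vec \<rho> T) (p_vec \<rho> T) m n + outer (q_vec \<rho> T) (q_vec \<rho> T) m n))
          integrable_on {T\<^sub>1..T\<^sub>2} \<and>
        Delta_arch L T\<^sub>1 T\<^sub>2 m n =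
          1 / pi\<^sup>2 * integral {T\<^sub>1..T\<^sub>2}
            (\<lambda>T. h_plus T * ((sin (L * T / 2))\<^sup>2 / \<rho>) *
                 (outer (p_vec \<rho> T) (p_vec \<rho> T) m n + outer (q_vec \<rho> T) (q_vec \<rho> T) m n)))
     \<and> complex_pos_def_on (idx N) (\<lambda>m n. complex_of_real (Delta_arch L T\<^sub>1 T\<^sub>2 m n))
     \<and> pos_def_on_even (idx N) (Delta_arch L T\<^sub>1 T\<^sub>2)
     \<and> (\<forall>k ms ns. 1 \<le> k \<longrightarrow> k \<le> 2 * N + 1 \<longrightarrow>
          strict_mono_on {..<k} ms \<longrightarrow> ms ` {..<k} \<subseteq> idx N \<longrightarrow>
          strict_mono_on {..<k} ns \<longrightarrow> ns ` {..<k} \<subseteq> idx N \<longrightarrow>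
          minor k (Delta_arch L T\<^sub>1 T\<^sub>2) ms ns > 0)"
proof -
  let ?f = "\<lambda>m n T. h_plus T * ((sin (L * T / 2))\<^sup>2 / \<rho>) *
    (outer (p_vec \<rho> T) (p_vec \<rho> T) m n + outer (q_vec \<rho> T) (q_vec \<rho> T) m n)"
  let ?\<Delta> = "Delta_arch L T\<^sub>1 T\<^sub>2"
  have L: "L > 0" using assms(1,2) by simp
  then have \<rho>: "\<rho> > 0" using assms(3) by simp
  have T: "\<rho> * real N < T\<^sub>1" "7 < T\<^sub>1" "T\<^sub>1 < T\<^sub>2" using assms(4,5) by auto
  interpret weighted_kernel "arch_weight L \<rho>" T\<^sub>1 T\<^sub>2
    using weighted_kernel_arch_weight[OF L \<rho>] T by simp
  have idx: "\<rho> * \<bar>real_of_int n\<bar> < T\<^sub>1" if "n \<in> idx N" for n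
  proof -
    have "\<bar>real_of_int n\<bar> \<le> real N" using that by (auto simp: idx_def)
    then have "\<rho> * \<bar>real_of_int n\<bar> \<le> \<rho> * real N" using \<rho> by (intro mult_left_mono) auto
    then show ?thesis using T by linarith
  qed
  have node: "\<rho> * real_of_int n \<in> nodes" if "n \<in> idx N" for n
  proof -
    have "\<bar>\<rho> * real_of_int n\<bar> < T\<^sub>1" using idx[OF that] \<rho> by (simp add: abs_mult)
    then show ?thesis by auto
  qed
  have repr: "?\<Delta> m n = 1 / pi\<^sup>2 * integral {T\<^sub>1..T\<^sub>2} (?f m n)"
    if "m \<in> idx N" "n \<in> idx N" for m n
    using that idx T by (intro Delta_arch_eq_integral L assms(3)) auto
  have int: "(?f m n) integrable_on {T\<^sub>1..T\<^sub>2}" if "m \<in> idx N" "n \<in> idx N" for m n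
  proof -
    have nz: "1 / pi\<^sup>2 \<noteq> (0 :: real)" by simp
    have "(\<lambda>T. 1 / pi\<^sup>2 * ?f m n T) integrable_on {T\<^sub>1..T\<^sub>2}"
      using integrable_continuous_real[OF continuous_on_ker_integrand[OF node node, OF that]]
      by (simp only: arch_weight_times_kernel[OF \<rho>])
    then show ?thesis by (rule iffD1[OF integrable_on_cmult_iff[OF nz]])
  qed
  have ker: "?\<Delta> m n = ker (\<rho> * m) (\<rho> * n)" if "m \<in> idx N" "n \<in> idx N" for m n
  proof -
    have "ker (\<rho> * m) (\<rho> * n) = integral {T\<^sub>1..T\<^sub>2} (\<lambda>T. 1 / pi\<^sup>2 * ?f m n T)"
      unfolding ker_def by (intro integral_cong arch_weight_times_kernel \<rho>)
    also have "\<dots> = 1 / pi\<^sup>2 * integral {T\<^sub>1..T\<^sub>2} (?f m n)"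
      by (rule integral_mult_right)
    finally show ?thesis unfolding repr[OF that] by (rule sym)
  qed
  have pd: "(\<Sum>m\<in>idx N. \<Sum>n\<in>idx N. x m * ?\<Delta> m n * x n) > 0"
    if "k \<in> idx N" "x k \<noteq> 0" for x :: "int \<Rightarrow> real" and k
  proof -
    have "(\<Sum>m\<in>idx N. \<Sum>n\<in>idx N. x m * ker (\<rho> * m) (\<rho> * n) * x n) > 0"
      using that \<rho> node by (intro ker_pos_def) (auto simp: idx_def inj_on_def)
    then show ?thesis by (simp add: ker)
  qed
  have "complex_pos_def_on (idx N) (\<lambda>m n. complex_of_real (?\<Delta> m n))"
  proof (rule complex_pos_def_on_of_real)
    show "finite (idx N)" by (simp add: idx_def)
    show "?\<Delta> m n = ?\<Delta> n m" if "m \<in> idx N" "n \<in> idx N" for m n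
      using that by (simp add: ker ker_def mult.commute)
  qed (rule pd)
  moreover have "pos_def_on_even (idx N) ?\<Delta>"
    unfolding pos_def_on_even_def using pd by blast
  moreover have "minor k ?\<Delta> ms ns > 0"
    if "strict_mono_on {..<k} ms" "ms ` {..<k} \<subseteq> idx N" "strict_mono_on {..<k} ns" "ns ` {..<k} \<subseteq> idx N"
    for k ms ns
  proof -
    have "Determinant.det (Matrix.mat k k (\<lambda>(i, j). ker (\<rho> * ms i) (\<rho> * ns j))) > 0"
    proof (rule ker_strictly_totally_positive)
      show "strict_mono_on {..<k} (\<lambda>i. \<rho> * ms i)" "strict_mono_on {..<k} (\<lambda>i. \<rho> * ns i)"
        using that(1,3) \<rho> by (simp_all add: strict_mono_on_def)
      show "(\<lambda>i. \<rho> * ms i) ` {..<k} \<subseteq> nodes" "(\<lambda>i. \<rho> * ns i) ` {..<k} \<subseteq> nodes"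
        using that(2,4) node by blast+
    qed
    moreover have "Matrix.mat k k (\<lambda>(i, j). ?\<Delta> (ms i) (ns j)) =
        Matrix.mat k k (\<lambda>(i, j). ker (\<rho> * ms i) (\<rho> * ns j))"
      using that(2,4) by (intro cong_mat) (auto simp: ker image_subset_iff)
    ultimately show ?thesis by (simp add: minor_def)
  qed
  ultimately show ?thesis using int repr by blast
qed

end
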